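(* Let $G$ be a König–Egerváry graph. Then: (i) for every $\alpha$-critical edge $e$ of $G$, the graph $G-e$ is also a König–Egerváry graph; (ii) every $\alpha$-critical edge of $G$ is also $\mu$-critical; (iii) the set of all $\alpha$-critical edges of $G$ is a matching (no two $\alpha$-critical edges share an endpoint).
   Context: All graphs are finite and simple; following the paper's standing convention, "graph" means a connected graph with at least one edge (the definitions below make sense for arbitrary finite simple graphs). $\alpha(G)$ is the stability number (maximum size of a stable set), $\mu(G)$ the size of a maximum matching, $n(G)=|V(G)|$. $G$ is a König–Egerváry graph if $\alpha(G)+\mu(G)=n(G)$. For an edge $e$, $G-e$ denotes the graph obtained by deleting $e$ (keeping all vertices). An edge $e$ is $\alpha$-critical if $\alpha(G-e)>\alpha(G)$, and $\mu$-critical if $\mu(G-e)<\mu(G)$. *)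

theory Defs
  imports Main
begin

text \<open>A graph is given by its vertex set \<open>V\<close> and its edge set \<open>E\<close>, an edge being the
  two-element set of its endpoints. Thus \<open>G - e\<close> is the pair \<open>V\<close>, \<open>E - {e}\<close>.\<close>

definition finite_simple_graph :: "'a set \<Rightarrow> 'a set set \<Rightarrow> bool" where
  "finite_simple_graph V E \<longleftrightarrow> finite V \<and> (\<forall>e\<in>E. e \<subseteq> V \<and> card e = 2)"

definition connected_graph :: "'a set \<Rightarrow> 'a set set \<Rightarrow> bool" where
  "connected_graph V E \<longleftrightarrow> V \<noteq> {} \<and> (\<forall>u\<in>V. \<forall>v\<in>V. (u, v) \<in> {(x, y). {x, y} \<in> E}\<^sup>*)"

definition stable_set :: "'a set \<Rightarrow> 'a set set \<Rightarrow> 'a set \<Rightarrow> bool" where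
  "stable_set V E S \<longleftrightarrow> S \<subseteq> V \<and> (\<forall>x\<in>S. \<forall>y\<in>S. {x, y} \<notin> E)"

definition matching :: "'a set set \<Rightarrow> 'a set set \<Rightarrow> bool" where
  "matching E M \<longleftrightarrow> M \<subseteq> E \<and> pairwise disjnt M"

definition stability_number :: "'a set \<Rightarrow> 'a set set \<Rightarrow> nat" where
  "stability_number V E = Max (card ` {S. stable_set V E S})"

definition matching_number :: "'a set set \<Rightarrow> nat" where
  "matching_number E = Max (card ` {M. matching E M})"

definition koenig_egervary :: "'a set \<Rightarrow> 'a set set \<Rightarrow> bool" where
  "koenig_egervary V E \<longleftrightarrow> stability_number V E + matching_number E = card V"

definition alpha_critical :: "'a set \<Rightarrow> 'a set set \<Rightarrow> 'a set \<Rightarrow> bool" where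
  "alpha_critical V E e \<longleftrightarrow> e \<in> E \<and> stability_number V (E - {e}) > stability_number V E"

definition mu_critical :: "'a set set \<Rightarrow> 'a set \<Rightarrow> bool" where
  "mu_critical E e \<longleftrightarrow> e \<in> E \<and> matching_number (E - {e}) < matching_number E"

end

theory Submission
  imports Defs
begin

text \<open>The complement of a stable set is a vertex cover, and a vertex cover has at least as many
  vertices as a matching has edges, so \<open>\<alpha> + \<mu> \<le> n\<close> in every graph. If \<open>G\<close> attains equality and
  deleting \<open>e\<close> increases \<open>\<alpha>\<close>, this bound for \<open>G - e\<close> forces \<open>\<mu>\<close> to drop; as it drops by at most
  one, \<open>G - e\<close> attains equality as well. Finally, a \<open>\<mu>\<close>-critical edge belongs to every maximum
  matching, so the \<open>\<mu>\<close>-critical edges, and with them the \<open>\<alpha>\<close>-critical ones, form a matching.\<close>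

lemma finite_simple_graph_finite_edges:
  assumes "finite_simple_graph V E"
  shows "finite E"
proof (rule finite_subset)
  show "E \<subseteq> Pow V" "finite (Pow V)"
    using assms by (auto simp: finite_simple_graph_def)
qed

lemma finite_simple_graph_subset:
  "finite_simple_graph V E \<Longrightarrow> F \<subseteq> E \<Longrightarrow> finite_simple_graph V F"
  by (auto simp: finite_simple_graph_def)

lemma matching_subset: "matching E M \<Longrightarrow> N \<subseteq> M \<Longrightarrow> matching E N"
  by (auto simp: matching_def intro: pairwise_subset)

lemma matching_Diff_iff: "matching (E - F) M \<longleftrightarrow> matching E M \<and> M \<inter> F = {}"
  by (auto simp: matching_def)

lemma finite_matchings:
  assumes "finite E"
  shows "finite {M. matching E M}"
proof (rule finite_subset)
  show "{M. matching E M} \<subseteq> Pow E" "finite (Pow E)"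
    using assms by (auto simp: matching_def)
qed

lemma card_le_matching_number:
  assumes "finite E" "matching E M"
  shows "card M \<le> matching_number E"
  unfolding matching_number_def using assms by (intro Max_ge) (auto simp: finite_matchings)

lemma ex_maximum_matching:
  assumes "finite E"
  obtains M where "matching E M" "card M = matching_number E"
proof -
  have "matching E {}"
    by (simp add: matching_def)
  then have "matching_number E \<in> card ` {M. matching E M}"
    unfolding matching_number_def using finite_matchings[OF assms] by (intro Max_in) auto
  then show thesis
    using that by auto
qed

lemma finite_stable_sets:
  assumes "finite V"
  shows "finite {S. stable_set V E S}"
proof (rule finite_subset)
  show "{S. stable_set V E S} \<subseteq> Pow V" "finite (Pow V)"
    using assms by (auto simp: stable_set_def)
qed

lemma ex_maximum_stable_set:
  assumes "finite V"
  obtains S where "stable_set V E S" "card S = stability_number V E"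
proof -
  have "stable_set V E {}"
    by (simp add: stable_set_def)
  then have "stability_number V E \<in> card ` {S. stable_set V E S}"
    unfolding stability_number_def using finite_stable_sets[OF assms] by (intro Max_in) auto
  then show thesis
    using that by auto
qed

definition vertex_cover :: "'a set set \<Rightarrow> 'a set \<Rightarrow> bool" where
  "vertex_cover E C \<longleftrightarrow> (\<forall>e\<in>E. \<exists>v\<in>C. v \<in> e)"

lemma card_matching_le_card_vertex_cover:
  assumes "finite C" "vertex_cover E C" "matching E M"
  shows "card M \<le> card C"
proof (rule card_le_if_inj_on_rel[where r = "\<lambda>e v. v \<in> e"])
  show "\<exists>v. v \<in> C \<and> v \<in> e" if "e \<in> M" for e
    using that assms(2,3) by (auto simp: vertex_cover_def matching_def)
  show "e = e'" if "e \<in> M" "e' \<in> M" "v \<in> e" "v \<in> e'" for e e' v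
    using that assms(3) by (auto simp: matching_def pairwise_def disjnt_iff)
qed (fact assms(1))

lemma stable_set_imp_vertex_cover_Diff:
  assumes "finite_simple_graph V E" "stable_set V E S"
  shows "vertex_cover E (V - S)"
  unfolding vertex_cover_def
proof
  fix e assume "e \<in> E"
  then have "e \<subseteq> V" "card e = 2"
    using assms(1) by (auto simp: finite_simple_graph_def)
  then obtain x y where "e = {x, y}"
    by (auto simp: card_2_iff)
  with \<open>e \<in> E\<close> \<open>e \<subseteq> V\<close> show "\<exists>v\<in>V - S. v \<in> e"
    using assms(2) by (auto simp: stable_set_def)
qed

lemma card_stable_set_add_card_matching_le:
  assumes "finite_simple_graph V E" "stable_set V E S" "matching E M"
  shows "card S + card M \<le> card V"
proof -
  have "finite V" "S \<subseteq> V"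
    using assms by (auto simp: finite_simple_graph_def stable_set_def)
  then have "card M \<le> card (V - S)"
    using card_matching_le_card_vertex_cover stable_set_imp_vertex_cover_Diff assms by blast
  also have "\<dots> = card V - card S"
    using \<open>finite V\<close> \<open>S \<subseteq> V\<close> by (intro card_Diff_subset) (auto intro: finite_subset)
  finally show ?thesis
    using card_mono[OF \<open>finite V\<close> \<open>S \<subseteq> V\<close>] by linarith
qed

lemma stability_number_add_matching_number_le:
  assumes "finite_simple_graph V E"
  shows "stability_number V E + matching_number E \<le> card V"
proof -
  have "finite V"
    using assms by (simp add: finite_simple_graph_def)
  then obtain S where "stable_set V E S" "card S = stability_number V E"
    by (rule ex_maximum_stable_set)
  moreover obtain M where "matching E M" "card M = matching_number E"
    using finite_simple_graph_finite_edges[OF assms] by (rule ex_maximum_matching)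
  ultimately show ?thesis
    using card_stable_set_add_card_matching_le[OF assms] by metis
qed

lemma matching_number_le_Diff_add_card:
  assumes "finite E" "finite F"
  shows "matching_number E \<le> matching_number (E - F) + card F"
proof -
  obtain M where M: "matching E M" "card M = matching_number E"
    using ex_maximum_matching[OF assms(1)] .
  have "matching (E - F) (M - F)"
    using matching_subset[OF M(1)] by (auto simp: matching_Diff_iff)
  then have "card (M - F) \<le> matching_number (E - F)"
    using assms(1) by (simp add: card_le_matching_number)
  then show ?thesis
    using diff_card_le_card_Diff[OF assms(2), of M] M(2) by linarith
qed

lemma mu_critical_mem_maximum_matching:
  assumes "finite E" "mu_critical E e" "matching E M" "card M = matching_number E"
  shows "e \<in> M"
proof (rule ccontr)
  assume "e \<notin> M"
  then have "card M \<le> matching_number (E - {e})"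
    using assms(1,3) by (intro card_le_matching_number) (auto simp: matching_Diff_iff)
  then show False
    using assms(2,4) by (simp add: mu_critical_def)
qed

lemma matching_mu_critical_edges:
  assumes "finite E"
  shows "matching E {e. mu_critical E e}"
proof -
  obtain M where M: "matching E M" "card M = matching_number E"
    using ex_maximum_matching[OF assms] .
  then have "{e. mu_critical E e} \<subseteq> M"
    using mu_critical_mem_maximum_matching[OF assms] by blast
  with M(1) show ?thesis
    by (rule matching_subset)
qed

lemma koenig_egervary_alpha_critical_imp_mu_critical:
  assumes "finite_simple_graph V E" "koenig_egervary V E" "alpha_critical V E e"
  shows "mu_critical E e"
proof -
  have "stability_number V (E - {e}) + matching_number (E - {e}) \<le> card V"
    using finite_simple_graph_subset[OF assms(1) Diff_subset]
    by (rule stability_number_add_matching_number_le)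
  also have "\<dots> = stability_number V E + matching_number E"
    using assms(2) by (simp add: koenig_egervary_def)
  finally show ?thesis
    using assms(3) by (simp add: alpha_critical_def mu_critical_def)
qed

lemma koenig_egervary_delete_alpha_critical:
  assumes "finite_simple_graph V E" "koenig_egervary V E" "alpha_critical V E e"
  shows "koenig_egervary V (E - {e})"
  unfolding koenig_egervary_def
proof (rule antisym)
  show "stability_number V (E - {e}) + matching_number (E - {e}) \<le> card V"
    using finite_simple_graph_subset[OF assms(1) Diff_subset]
    by (rule stability_number_add_matching_number_le)
  have "card V = stability_number V E + matching_number E"
    using assms(2) by (simp add: koenig_egervary_def)
  also have "\<dots> \<le> stability_number V E + (matching_number (E - {e}) + 1)"
    using finite_simple_graph_finite_edges[OF assms(1)]
      matching_number_le_Diff_add_card[of E "{e}"] by simp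
  also have "\<dots> \<le> stability_number V (E - {e}) + matching_number (E - {e})"
    using assms(3) by (simp add: alpha_critical_def)
  finally show "card V \<le> stability_number V (E - {e}) + matching_number (E - {e})" .
qed

theorem theorem2p3:
  fixes V :: "'a set" and E :: "'a set set"
  assumes "finite_simple_graph V E"
    and "connected_graph V E"
    and "E \<noteq> {}"
    and "koenig_egervary V E"
  shows "(\<forall>e. alpha_critical V E e \<longrightarrow> koenig_egervary V (E - {e}))
    \<and> (\<forall>e. alpha_critical V E e \<longrightarrow> mu_critical E e)
    \<and> matching E {e. alpha_critical V E e}"
proof (intro conjI allI impI)
  show "koenig_egervary V (E - {e})" if "alpha_critical V E e" for e
    using assms(1,4) that by (rule koenig_egervary_delete_alpha_critical)
  show mu_critical: "mu_critical E e" if "alpha_critical V E e" for e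
    using assms(1,4) that by (rule koenig_egervary_alpha_critical_imp_mu_critical)
  have "matching E {e. mu_critical E e}"
    using finite_simple_graph_finite_edges[OF assms(1)] by (rule matching_mu_critical_edges)
  then show "matching E {e. alpha_critical V E e}"
    by (rule matching_subset) (auto intro: mu_critical)
qed

end
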